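(* Let $G$ be a graph. The parameter $\alpha_q(G)$ is equal to the maximum $t\in\mathbb N$ for which there exists a matrix $X\in\mathcal{CS}_+^{|V(G)|t+1}$, indexed by $(V(G)\times[t])\cup\{0\}$, satisfying: (C1) $X_{0,0}=1$; (C2a) $\sum_{u\in V(G)}X_{0,ui}=1$ for all $i\in[t]$; (C2b) $\sum_{u,v\in V(G)}X_{ui,vi}=1$ for all $i\in[t]$; (O1) $X_{ui,vj}=0$ for all $i\ne j\in[t]$ and all $u\simeq v\in V(G)$; (O2) $X_{ui,vi}=0$ for all $i\in[t]$ and all $u\ne v\in V(G)$. Moreover, the parameter $\alpha^\star(G)$ is equal to the maximum integer $t$ for which there exists a matrix $X\in\mathcal{CS}_+^{|V(G)|t+1}$ satisfying (C1), (C2a), (C2b) and (O1).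
   Context: Graphs are finite, undirected, without loops, with at least one vertex; $[t]=\{1,\dots,t\}$; $u\simeq v$ means $u=v$ or $u,v$ adjacent; $ui$ abbreviates the index $(u,i)$. $\mathcal S^d$ denotes the real symmetric $d\times d$ matrices with trace inner product $\langle X,Y\rangle=\mathrm{Tr}(XY)$, and $\mathcal S^d_+$ the positive semidefinite ones. $\mathcal{CS}_+^m$ is the set of $A\in\mathcal S^m$ for which there exist $d\ge1$ and $X_1,\dots,X_m\in\mathcal S^d_+$ with $A_{ij}=\langle X_i,X_j\rangle$ for all $i,j$. $\alpha_q(G)$ is the maximum $t\in\mathbb N$ for which there exist $d\ge1$ and $\rho,\rho_i^u\in\mathcal S^d_+$ ($i\in[t]$, $u\in V(G)$) with: (a) $\langle\rho,\rho\rangle=1$; (b) $\sum_{u\in V(G)}\rho_i^u=\rho$ for all $i\in[t]$; (c) $\langle\rho_i^u,\rho_j^v\rangle=0$ for all $i\ne j\in[t]$ and $u\simeq v\in V(G)$; (d) $\langle\rho_i^u,\rho_i^v\rangle=0$ for all $i\in[t]$ and $u\ne v\in V(G)$. $\alpha^\star(G)$ is defined in the same way with only conditions (a), (b), (c). *)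

theory Defs
  imports
    Complex_Main
    "Graph_Theory.Digraph"
    "Jordan_Normal_Form.Matrix"
begin

text \<open>
  Graphs are modelled by the locale predicate \<^const>\<open>graph\<close>: finite, loop-free digraphs without
  parallel arcs whose arc relation is symmetric, an edge being a pair of opposite arcs.
  Matrices of varying size \<open>d\<close> are elements of \<^term>\<open>carrier_mat d d\<close>.
\<close>

definition adj_or_eq :: "('a, 'b) pre_digraph \<Rightarrow> 'a \<Rightarrow> 'a \<Rightarrow> bool" where
  "adj_or_eq G u v \<longleftrightarrow> u = v \<or> u \<rightarrow>\<^bsub>G\<^esub> v"

definition sym_mats :: "nat \<Rightarrow> real mat set" where
  "sym_mats d = {A \<in> carrier_mat d d. transpose_mat A = A}"

definition psd_mats :: "nat \<Rightarrow> real mat set" where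
  "psd_mats d = {A \<in> sym_mats d. \<forall>x \<in> carrier_vec d. x \<bullet> (A *\<^sub>v x) \<ge> 0}"

definition mat_trace :: "real mat \<Rightarrow> real" where
  "mat_trace A = (\<Sum>a<dim_row A. A $$ (a, a))"

definition trace_inner :: "real mat \<Rightarrow> real mat \<Rightarrow> real" where
  "trace_inner A B = mat_trace (A * B)"

text \<open>The type of matrices has no additive monoid structure, so finite sums are taken entrywise.\<close>

definition mat_sum :: "nat \<Rightarrow> ('a \<Rightarrow> real mat) \<Rightarrow> 'a set \<Rightarrow> real mat" where
  "mat_sum d F S = mat d d (\<lambda>(a, b). \<Sum>u\<in>S. F u $$ (a, b))"

text \<open>
  The cone of completely positive semidefinite matrices whose rows and columns are indexed by a
  finite set \<open>I\<close>, i.e. of order \<open>m = card I\<close>. A matrix is a function of two indices of which only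
  the values on \<open>I \<times> I\<close> matter.
\<close>

definition cs_plus :: "'i set \<Rightarrow> ('i \<Rightarrow> 'i \<Rightarrow> real) set" where
  "cs_plus I = {A. (\<forall>i\<in>I. \<forall>j\<in>I. A i j = A j i) \<and>
     (\<exists>d\<ge>1. \<exists>X. (\<forall>i\<in>I. X i \<in> psd_mats d) \<and>
       (\<forall>i\<in>I. \<forall>j\<in>I. A i j = trace_inner (X i) (X j)))}"

text \<open>
  Conditions (a), (b) and (c) on \<open>\<rho>\<close> and \<open>\<rho>\<^sub>i\<^sup>u = R i u\<close>. With the additional condition (d)
  they define the quantum stability number.
\<close>

definition star_solution ::
  "('a, 'b) pre_digraph \<Rightarrow> nat \<Rightarrow> nat \<Rightarrow> real mat \<Rightarrow> (nat \<Rightarrow> 'a \<Rightarrow> real mat) \<Rightarrow> bool" where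
  "star_solution G t d \<rho> R \<longleftrightarrow>
     \<rho> \<in> psd_mats d \<and>
     (\<forall>i\<in>{1..t}. \<forall>u\<in>verts G. R i u \<in> psd_mats d) \<and>
     trace_inner \<rho> \<rho> = 1 \<and>
     (\<forall>i\<in>{1..t}. mat_sum d (R i) (verts G) = \<rho>) \<and>
     (\<forall>i\<in>{1..t}. \<forall>j\<in>{1..t}. \<forall>u\<in>verts G. \<forall>v\<in>verts G.
        i \<noteq> j \<longrightarrow> adj_or_eq G u v \<longrightarrow> trace_inner (R i u) (R j v) = 0)"

definition quantum_solution ::
  "('a, 'b) pre_digraph \<Rightarrow> nat \<Rightarrow> nat \<Rightarrow> real mat \<Rightarrow> (nat \<Rightarrow> 'a \<Rightarrow> real mat) \<Rightarrow> bool" where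
  "quantum_solution G t d \<rho> R \<longleftrightarrow>
     star_solution G t d \<rho> R \<and>
     (\<forall>i\<in>{1..t}. \<forall>u\<in>verts G. \<forall>v\<in>verts G.
        u \<noteq> v \<longrightarrow> trace_inner (R i u) (R i v) = 0)"

definition alpha_q :: "('a, 'b) pre_digraph \<Rightarrow> nat" where
  "alpha_q G = (GREATEST t. \<exists>d\<ge>1. \<exists>\<rho> R. quantum_solution G t d \<rho> R)"

definition alpha_star :: "('a, 'b) pre_digraph \<Rightarrow> nat" where
  "alpha_star G = (GREATEST t. \<exists>d\<ge>1. \<exists>\<rho> R. star_solution G t d \<rho> R)"

text \<open>
  Unlike \<^term>\<open>m = (GREATEST t. P t)\<close>, this also says that the maximum exists.
\<close>

definition is_maximum :: "(nat \<Rightarrow> bool) \<Rightarrow> nat \<Rightarrow> bool" where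
  "is_maximum P m \<longleftrightarrow> P m \<and> (\<forall>t. P t \<longrightarrow> t \<le> m)"

text \<open>
  The index set \<open>(V(G) \<times> [t]) \<union> {0}\<close>: \<^term>\<open>None\<close> is the extra index \<open>0\<close>, and \<^term>\<open>Some (u, i)\<close>
  is the index \<open>ui\<close>.
\<close>

definition idx :: "('a, 'b) pre_digraph \<Rightarrow> nat \<Rightarrow> ('a \<times> nat) option set" where
  "idx G t = insert None (Some ` (verts G \<times> {1..t}))"

type_synonym 'a idx_mat = "('a \<times> nat) option \<Rightarrow> ('a \<times> nat) option \<Rightarrow> real"

definition cond_C1 :: "'a idx_mat \<Rightarrow> bool" where
  "cond_C1 X \<longleftrightarrow> X None None = 1"

definition cond_C2a :: "('a, 'b) pre_digraph \<Rightarrow> nat \<Rightarrow> 'a idx_mat \<Rightarrow> bool" where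
  "cond_C2a G t X \<longleftrightarrow> (\<forall>i\<in>{1..t}. (\<Sum>u\<in>verts G. X None (Some (u, i))) = 1)"

definition cond_C2b :: "('a, 'b) pre_digraph \<Rightarrow> nat \<Rightarrow> 'a idx_mat \<Rightarrow> bool" where
  "cond_C2b G t X \<longleftrightarrow>
     (\<forall>i\<in>{1..t}. (\<Sum>u\<in>verts G. \<Sum>v\<in>verts G. X (Some (u, i)) (Some (v, i))) = 1)"

definition cond_O1 :: "('a, 'b) pre_digraph \<Rightarrow> nat \<Rightarrow> 'a idx_mat \<Rightarrow> bool" where
  "cond_O1 G t X \<longleftrightarrow>
     (\<forall>i\<in>{1..t}. \<forall>j\<in>{1..t}. \<forall>u\<in>verts G. \<forall>v\<in>verts G.
        i \<noteq> j \<longrightarrow> adj_or_eq G u v \<longrightarrow> X (Some (u, i)) (Some (v, j)) = 0)"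

definition cond_O2 :: "('a, 'b) pre_digraph \<Rightarrow> nat \<Rightarrow> 'a idx_mat \<Rightarrow> bool" where
  "cond_O2 G t X \<longleftrightarrow>
     (\<forall>i\<in>{1..t}. \<forall>u\<in>verts G. \<forall>v\<in>verts G.
        u \<noteq> v \<longrightarrow> X (Some (u, i)) (Some (v, i)) = 0)"

end

theory Submission
  imports Defs
begin

text \<open>
  The Gram matrix of \<open>\<rho>\<close> and the \<open>\<rho>\<^sub>i\<^sup>u\<close> satisfies the conditions; conversely, (C1), (C2a) and
  (C2b) give \<open>\<parallel>\<rho> - (\<Sum>u. \<rho>\<^sub>i\<^sup>u)\<parallel>\<^sup>2 = 1 - 2 + 1 = 0\<close> for any Gram representation of \<open>X\<close>. Hence both
  problems are feasible for the same \<open>t\<close>. The maximum exists because \<open>t \<le> |V|\<close>: writing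
  \<open>\<sigma>\<^sub>u = (\<Sum>i. \<rho>\<^sub>i\<^sup>u)\<close>, Cauchy-Schwarz gives
  \<open>t\<^sup>2 = \<parallel>\<Sum>u. \<sigma>\<^sub>u\<parallel>\<^sup>2 \<le> |V| (\<Sum>u. \<parallel>\<sigma>\<^sub>u\<parallel>\<^sup>2) = |V| (\<Sum>u i. \<parallel>\<rho>\<^sub>i\<^sup>u\<parallel>\<^sup>2) \<le> |V| (\<Sum>i. \<parallel>\<rho>\<parallel>\<^sup>2) = |V| t\<close>,
  where the last inequality uses that positive semidefinite matrices have nonnegative inner products.
\<close>

section \<open>Positive semidefinite forms on a finite index set\<close>

text \<open>Indexing by an arbitrary set instead of \<open>{..<d}\<close> lets an induction delete
  one index without renumbering the others.\<close>

definition psd_on :: "'a set \<Rightarrow> ('a \<Rightarrow> 'a \<Rightarrow> real) \<Rightarrow> bool" where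
  "psd_on S A \<longleftrightarrow> (\<forall>a\<in>S. \<forall>b\<in>S. A a b = A b a) \<and> (\<forall>x. 0 \<le> (\<Sum>a\<in>S. \<Sum>b\<in>S. x a * A a b * x b))"

lemma psd_on_sym: "psd_on S A \<Longrightarrow> a \<in> S \<Longrightarrow> b \<in> S \<Longrightarrow> A a b = A b a"
  unfolding psd_on_def by blast

lemma double_sum_insert:
  fixes f :: "'a \<Rightarrow> 'a \<Rightarrow> real"
  assumes "finite S" "k \<notin> S"
  shows "(\<Sum>a\<in>insert k S. \<Sum>b\<in>insert k S. f a b) =
    f k k + (\<Sum>b\<in>S. f k b) + (\<Sum>a\<in>S. f a k) + (\<Sum>a\<in>S. \<Sum>b\<in>S. f a b)"
  using assms by (simp add: sum.distrib)

text \<open>Evaluate the form at \<open>x(k := c)\<close>; symmetry merges the two cross sums. The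
  result is a quadratic polynomial in \<open>c\<close>, and the following lemmas come from suitable
  choices of \<open>c\<close> and \<open>x\<close>.\<close>

lemma psd_on_insert_form:
  fixes A :: "'a \<Rightarrow> 'a \<Rightarrow> real"
  assumes "finite S" "k \<notin> S" "psd_on (insert k S) A"
  shows "0 \<le> A k k * c\<^sup>2 + 2 * c * (\<Sum>b\<in>S. A k b * x b) + (\<Sum>a\<in>S. \<Sum>b\<in>S. x a * A a b * x b)"
proof -
  let ?y = "x(k := c)"
  have off: "?y a = x a" if "a \<in> S" for a
    using that assms(2) by auto
  have "0 \<le> (\<Sum>a\<in>insert k S. \<Sum>b\<in>insert k S. ?y a * A a b * ?y b)"
    using assms(3) unfolding psd_on_def by blast
  also have "\<dots> = c * A k k * c + (\<Sum>b\<in>S. c * A k b * x b) + (\<Sum>a\<in>S. x a * A a k * c)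
      + (\<Sum>a\<in>S. \<Sum>b\<in>S. x a * A a b * x b)"
    using off by (subst double_sum_insert[OF assms(1,2)]) (simp cong: sum.cong)
  also have "(\<Sum>a\<in>S. x a * A a k * c) = (\<Sum>b\<in>S. c * A k b * x b)"
    using psd_on_sym[OF assms(3), of _ k] by (intro sum.cong) (simp_all add: mult.commute)
  also have "(\<Sum>b\<in>S. c * A k b * x b) = c * (\<Sum>b\<in>S. A k b * x b)"
    by (simp add: sum_distrib_left mult.assoc)
  finally show ?thesis
    by (simp add: power2_eq_square algebra_simps)
qed

lemma psd_on_insert_subset:
  assumes "finite S" "k \<notin> S" "psd_on (insert k S) A"
  shows "psd_on S A"
  unfolding psd_on_def
proof (intro conjI allI ballI)
  show "A a b = A b a" if "a \<in> S" "b \<in> S" for a b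
    using psd_on_sym[OF assms(3)] that by blast
  show "0 \<le> (\<Sum>a\<in>S. \<Sum>b\<in>S. x a * A a b * x b)" for x
    using psd_on_insert_form[OF assms, of 0 x] by simp
qed

lemma psd_on_diag_nonneg:
  assumes "finite S" "k \<notin> S" "psd_on (insert k S) A"
  shows "0 \<le> A k k"
  using psd_on_insert_form[OF assms, of 1 "\<lambda>_. 0"] by simp

text \<open>When the diagonal entry vanishes, the form is affine in the coordinate at
  \<open>k\<close>, and an affine function that is nonnegative everywhere has slope 0.\<close>

lemma psd_on_zero_row:
  assumes "finite S" "k \<notin> S" "psd_on (insert k S) A" "A k k = 0" "b \<in> S"
  shows "A k b = 0"
proof (rule ccontr)
  assume nz: "A k b \<noteq> 0"
  let ?x = "\<lambda>a. if a = b then 1 else (0::real)"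
  have lin: "(\<Sum>a\<in>S. A k a * ?x a) = A k b"
    using assms(1,5) by (simp add: if_distrib sum.delta cong: if_cong)
  have "0 \<le> 2 * c * A k b + (\<Sum>a\<in>S. \<Sum>d\<in>S. ?x a * A a d * ?x d)" for c
    using psd_on_insert_form[OF assms(1-3), of c ?x] assms(4) unfolding lin by simp
  \<comment> \<open>This \<open>c\<close> is chosen so that the affine expression takes the value
    -1.\<close>
  from this[of "- ((\<Sum>a\<in>S. \<Sum>d\<in>S. ?x a * A a d * ?x d) + 1) / (2 * A k b)"] nz
  show False by (simp add: field_simps)
qed

text \<open>Minimising the form of \<open>A\<close> over the coordinate at \<open>k\<close> leaves
  exactly the form of the Schur complement.\<close>

lemma psd_on_schur_complement:
  fixes A :: "'a \<Rightarrow> 'a \<Rightarrow> real"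
  assumes "finite S" "k \<notin> S" "psd_on (insert k S) A" "A k k > 0"
  shows "psd_on S (\<lambda>a b. A a b - A k a * A k b / A k k)"
  unfolding psd_on_def
proof (intro conjI allI ballI)
  fix a b assume "a \<in> S" "b \<in> S"
  then have "A a b = A b a"
    using psd_on_sym[OF assms(3)] by blast
  then show "A a b - A k a * A k b / A k k = A b a - A k b * A k a / A k k"
    by simp
next
  fix x :: "'a \<Rightarrow> real"
  let ?l = "\<Sum>b\<in>S. A k b * x b"
  have "(\<Sum>a\<in>S. \<Sum>b\<in>S. x a * (A a b - A k a * A k b / A k k) * x b) =
      (\<Sum>a\<in>S. \<Sum>b\<in>S. x a * A a b * x b) - (\<Sum>a\<in>S. \<Sum>b\<in>S. (A k a * x a) * (A k b * x b)) / A k k"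
    by (simp add: algebra_simps sum_subtractf sum_divide_distrib)
  also have "(\<Sum>a\<in>S. \<Sum>b\<in>S. (A k a * x a) * (A k b * x b)) = ?l\<^sup>2"
    by (simp add: power2_eq_square sum_product)
  \<comment> \<open>The value \<open>- ?l / A k k\<close> is the minimiser of the quadratic
    polynomial in \<open>c\<close>.\<close>
  also have "(\<Sum>a\<in>S. \<Sum>b\<in>S. x a * A a b * x b) - ?l\<^sup>2 / A k k \<ge> 0"
    using psd_on_insert_form[OF assms(1-3), of "- ?l / A k k" x] assms(4)
    by (simp add: power2_eq_square field_simps)
  finally show "0 \<le> (\<Sum>a\<in>S. \<Sum>b\<in>S. x a * (A a b - A k a * A k b / A k k) * x b)" .
qed

text \<open>Symmetric Gaussian elimination takes the place of a spectral decomposition: each step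
  splits off a rank-one part of \<open>A\<close>, whose inner product with \<open>B\<close> is a
  value of the form of \<open>B\<close>. \<open>A\<close> is generalised in the induction because
  its Schur complement replaces it, while \<open>B\<close> is merely restricted.\<close>

lemma psd_on_inner_nonneg:
  fixes A B :: "'a \<Rightarrow> 'a \<Rightarrow> real"
  assumes "finite S" "psd_on S A" "psd_on S B"
  shows "0 \<le> (\<Sum>a\<in>S. \<Sum>b\<in>S. A a b * B a b)"
  using assms
proof (induction S arbitrary: A rule: finite_induct)
  case empty
  then show ?case by simp
next
  case (insert k S)
  note ins = insert.hyps(1,2)
  have B: "psd_on S B"
    using psd_on_insert_subset[OF ins insert.prems(2)] .
  have symA: "A a k = A k a" if "a \<in> S" for a
    using psd_on_sym[OF insert.prems(1)] that by blast
  show ?case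
  proof (cases "A k k = 0")
    case True
    have row: "A k b = 0" if "b \<in> S" for b
      using psd_on_zero_row[OF ins insert.prems(1) True that] .
    have "(\<Sum>a\<in>insert k S. \<Sum>b\<in>insert k S. A a b * B a b) = (\<Sum>a\<in>S. \<Sum>b\<in>S. A a b * B a b)"
      using True row symA by (subst double_sum_insert[OF ins]) simp
    also have "\<dots> \<ge> 0"
      using insert.IH[OF psd_on_insert_subset[OF ins insert.prems(1)] B] .
    finally show ?thesis .
  next
    case False
    with psd_on_diag_nonneg[OF ins insert.prems(1)] have pos: "A k k > 0" by simp
    let ?C = "\<lambda>a b. A a b - A k a * A k b / A k k"
    \<comment> \<open>This is the form of \<open>B\<close> at row \<open>k\<close> of
      \<open>A\<close>.\<close>
    have rank1: "0 \<le> (\<Sum>a\<in>insert k S. \<Sum>b\<in>insert k S. A k a * B a b * A k b)"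
      using insert.prems(2) unfolding psd_on_def by blast
    have "(\<Sum>a\<in>insert k S. \<Sum>b\<in>insert k S. A a b * B a b) =
        (\<Sum>a\<in>insert k S. \<Sum>b\<in>insert k S. ?C a b * B a b + A k a * B a b * A k b / A k k)"
      by (intro sum.cong refl) (simp add: algebra_simps)
    also have "\<dots> = (\<Sum>a\<in>insert k S. \<Sum>b\<in>insert k S. ?C a b * B a b) +
        (\<Sum>a\<in>insert k S. \<Sum>b\<in>insert k S. A k a * B a b * A k b) / A k k"
      by (simp only: sum.distrib sum_divide_distrib)
    \<comment> \<open>Row and column \<open>k\<close> of the Schur complement vanish, so only the
      block on \<open>S\<close> remains.\<close>
    also have "(\<Sum>a\<in>insert k S. \<Sum>b\<in>insert k S. ?C a b * B a b) = (\<Sum>a\<in>S. \<Sum>b\<in>S. ?C a b * B a b)"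
      using pos symA by (subst double_sum_insert[OF ins]) simp
    also have "\<dots> + (\<Sum>a\<in>insert k S. \<Sum>b\<in>insert k S. A k a * B a b * A k b) / A k k \<ge> 0"
      using insert.IH[OF psd_on_schur_complement[OF ins insert.prems(1) pos] B] rank1 pos
      by (intro add_nonneg_nonneg divide_nonneg_pos)
    finally show ?thesis .
  qed
qed

section \<open>The trace inner product in coordinates\<close>

text \<open>Symmetry of \<open>B\<close> turns Tr(AB) into the Euclidean inner product of the
  entries. Summing over pairs \<open>p\<close> lets matrices be handled as plain vectors from here
  on.\<close>

lemma trace_inner_entrywise:
  assumes "A \<in> sym_mats d" "B \<in> sym_mats d"
  shows "trace_inner A B = (\<Sum>p\<in>{..<d} \<times> {..<d}. A $$ p * B $$ p)"
proof -
  have dims: "A \<in> carrier_mat d d" "B \<in> carrier_mat d d" and symB: "transpose_mat B = B"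
    using assms by (auto simp: sym_mats_def)
  have "B $$ (b, a) = B $$ (a, b)" if "a < d" "b < d" for a b
    using that dims symB by (metis carrier_matD index_transpose_mat(1))
  then have "trace_inner A B = (\<Sum>a<d. \<Sum>b<d. A $$ (a, b) * B $$ (a, b))"
    using dims unfolding trace_inner_def mat_trace_def
    by (auto simp: scalar_prod_def atLeast0LessThan intro!: sum.cong)
  then show ?thesis
    by (simp add: sum.cartesian_product)
qed

lemma psd_mats_imp_psd_on:
  assumes "A \<in> psd_mats d"
  shows "psd_on {..<d} (\<lambda>a b. A $$ (a, b))"
proof -
  have dims: "A \<in> carrier_mat d d" and symA: "transpose_mat A = A"
    and pos: "\<And>v. v \<in> carrier_vec d \<Longrightarrow> v \<bullet> (A *\<^sub>v v) \<ge> 0"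
    using assms by (auto simp: psd_mats_def sym_mats_def)
  have "A $$ (a, b) = A $$ (b, a)" if "a < d" "b < d" for a b
    using that dims symA by (metis carrier_matD index_transpose_mat(1))
  moreover have "0 \<le> (\<Sum>a<d. \<Sum>b<d. x a * A $$ (a, b) * x b)" for x
  proof -
    have "vec d x \<bullet> (A *\<^sub>v vec d x) = (\<Sum>a<d. \<Sum>b<d. x a * A $$ (a, b) * x b)"
      using dims by (auto simp: scalar_prod_def atLeast0LessThan sum_distrib_left mult.assoc
          intro!: sum.cong)
    with pos[of "vec d x"] show ?thesis by simp
  qed
  ultimately show ?thesis
    unfolding psd_on_def by blast
qed

lemma trace_inner_nonneg:
  assumes "A \<in> psd_mats d" "B \<in> psd_mats d"
  shows "0 \<le> trace_inner A B"
proof -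
  have "A \<in> sym_mats d" "B \<in> sym_mats d"
    using assms by (auto simp: psd_mats_def)
  then show ?thesis
    using psd_on_inner_nonneg[OF _ psd_mats_imp_psd_on[OF assms(1)] psd_mats_imp_psd_on[OF assms(2)]]
    by (simp add: trace_inner_entrywise sum.cartesian_product)
qed

lemma trace_inner_commute:
  assumes "A \<in> sym_mats d" "B \<in> sym_mats d"
  shows "trace_inner A B = trace_inner B A"
  using assms by (simp add: trace_inner_entrywise mult.commute)

lemma mat_sum_sym:
  assumes "\<And>u. u \<in> S \<Longrightarrow> F u \<in> sym_mats d"
  shows "mat_sum d F S \<in> sym_mats d"
proof -
  have "F u $$ (b, a) = F u $$ (a, b)" if "u \<in> S" "a < d" "b < d" for u a b
    using assms[OF that(1)] that(2,3) unfolding sym_mats_def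
    by (metis (mono_tags, lifting) carrier_matD index_transpose_mat(1) mem_Collect_eq)
  then show ?thesis
    by (auto simp: sym_mats_def mat_sum_def intro!: eq_matI sum.cong)
qed

lemma trace_inner_mat_sum_right:
  assumes "A \<in> sym_mats d" "\<And>u. u \<in> S \<Longrightarrow> F u \<in> sym_mats d"
  shows "trace_inner A (mat_sum d F S) = (\<Sum>u\<in>S. trace_inner A (F u))"
proof -
  have "trace_inner A (mat_sum d F S) = (\<Sum>p\<in>{..<d} \<times> {..<d}. \<Sum>u\<in>S. A $$ p * F u $$ p)"
    using assms mat_sum_sym[of S F d]
    by (auto simp: trace_inner_entrywise mat_sum_def sum_distrib_left intro!: sum.cong)
  also have "\<dots> = (\<Sum>u\<in>S. trace_inner A (F u))"
    using assms by (subst sum.swap) (simp add: trace_inner_entrywise)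
  finally show ?thesis .
qed

lemma trace_inner_mat_sum_both:
  assumes "\<And>u. u \<in> S \<Longrightarrow> F u \<in> sym_mats d"
  shows "trace_inner (mat_sum d F S) (mat_sum d F S) = (\<Sum>u\<in>S. \<Sum>v\<in>S. trace_inner (F u) (F v))"
proof -
  have "trace_inner (mat_sum d F S) (mat_sum d F S) = (\<Sum>v\<in>S. trace_inner (mat_sum d F S) (F v))"
    using assms by (intro trace_inner_mat_sum_right mat_sum_sym)
  \<comment> \<open>Commuting the arguments puts the remaining sum on the right, where linearity is
    available; the outcome is the claim up to the names of the bound variables.\<close>
  also have "\<dots> = (\<Sum>v\<in>S. \<Sum>u\<in>S. trace_inner (F v) (F u))"
    using assms by (simp add: trace_inner_commute[OF mat_sum_sym] trace_inner_mat_sum_right)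
  finally show ?thesis .
qed

text \<open>The squared distance of \<open>A\<close> and \<open>B\<close> is 1 - 2 + 1 = 0. This is
  how condition (b) is recovered from (C1), (C2a) and (C2b).\<close>

lemma sym_mats_eqI:
  assumes "A \<in> sym_mats d" "B \<in> sym_mats d"
    and "trace_inner A A = 1" "trace_inner A B = 1" "trace_inner B B = 1"
  shows "A = B"
proof -
  have "(\<Sum>p\<in>{..<d} \<times> {..<d}. (A $$ p - B $$ p)\<^sup>2) =
      trace_inner A A - 2 * trace_inner A B + trace_inner B B"
    using assms(1,2)
    by (simp add: trace_inner_entrywise power2_eq_square algebra_simps sum.distrib sum_subtractf
        sum_distrib_left)
  also have "\<dots> = 0"
    using assms(3-5) by simp
  finally have "\<forall>p\<in>{..<d} \<times> {..<d}. A $$ p = B $$ p"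
    by (subst (asm) sum_nonneg_eq_0_iff) auto
  then show ?thesis
    using assms(1,2) by (intro eq_matI) (auto simp: sym_mats_def)
qed

section \<open>Gram matrices and feasible solutions\<close>

text \<open>By (b) and linearity, the sums in (C2a) and (C2b) both collapse to the squared norm of
  \<open>\<rho>\<close>. The matrix is given by an equation rather than existentially so that (O2)
  can be checked for the same \<open>X\<close>.\<close>

lemma star_solution_imp_gram:
  assumes sol: "star_solution G t d \<rho> R" and "d \<ge> 1"
    and "X = (\<lambda>p q. trace_inner (case p of None \<Rightarrow> \<rho> | Some (u, i) \<Rightarrow> R i u)
                      (case q of None \<Rightarrow> \<rho> | Some (u, i) \<Rightarrow> R i u))"
  shows "X \<in> cs_plus (idx G t)" "cond_C1 X" "cond_C2a G t X" "cond_C2b G t X" "cond_O1 G t X"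
proof -
  let ?Y = "\<lambda>p. case p of None \<Rightarrow> \<rho> | Some (u, i) \<Rightarrow> R i u"
  have psd: "\<rho> \<in> psd_mats d" "\<And>i u. i \<in> {1..t} \<Longrightarrow> u \<in> verts G \<Longrightarrow> R i u \<in> psd_mats d"
    and norm: "trace_inner \<rho> \<rho> = 1"
    and tot: "\<And>i. i \<in> {1..t} \<Longrightarrow> mat_sum d (R i) (verts G) = \<rho>"
    using sol by (auto simp: star_solution_def)
  have sym: "\<rho> \<in> sym_mats d" "\<And>i u. i \<in> {1..t} \<Longrightarrow> u \<in> verts G \<Longrightarrow> R i u \<in> sym_mats d"
    using psd by (auto simp: psd_mats_def)
  have Ypsd: "?Y p \<in> psd_mats d" if "p \<in> idx G t" for p
    using that psd by (auto simp: idx_def)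
  then have Ysym: "?Y p \<in> sym_mats d" if "p \<in> idx G t" for p
    using that by (auto simp: psd_mats_def)
  show "X \<in> cs_plus (idx G t)"
    unfolding cs_plus_def mem_Collect_eq
  proof (intro conjI ballI exI)
    show "X p q = X q p" if "p \<in> idx G t" "q \<in> idx G t" for p q
      unfolding assms(3) using trace_inner_commute[OF Ysym[OF that(1)] Ysym[OF that(2)]] .
    show "X p q = trace_inner (?Y p) (?Y q)" for p q
      by (simp add: assms(3))
  qed (use \<open>d \<ge> 1\<close> Ypsd in auto)
  show "cond_C1 X"
    using norm by (simp add: cond_C1_def assms(3))
  show "cond_C2a G t X"
    unfolding cond_C2a_def
  proof
    fix i assume i: "i \<in> {1..t}"
    show "(\<Sum>u\<in>verts G. X None (Some (u, i))) = 1"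
      using trace_inner_mat_sum_right[of \<rho> d "verts G" "R i"] sym(1) sym(2)[OF i] tot[OF i] norm
      by (simp add: assms(3))
  qed
  show "cond_C2b G t X"
    unfolding cond_C2b_def
  proof
    fix i assume i: "i \<in> {1..t}"
    show "(\<Sum>u\<in>verts G. \<Sum>v\<in>verts G. X (Some (u, i)) (Some (v, i))) = 1"
      using trace_inner_mat_sum_both[of "verts G" "R i" d] sym(2)[OF i] tot[OF i] norm
      by (simp add: assms(3))
  qed
  show "cond_O1 G t X"
    using sol by (auto simp: cond_O1_def star_solution_def assms(3))
qed

text \<open>Any Gram representation of \<open>X\<close> is itself a solution; only (b) needs an
  argument. The last obtained fact keeps the link to the entries of \<open>X\<close>, through which
  (O2) becomes (d).\<close>

lemma gram_imp_star_solution: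
  assumes "X \<in> cs_plus (idx G t)"
    and "cond_C1 X" "cond_C2a G t X" "cond_C2b G t X" "cond_O1 G t X"
  obtains d \<rho> R where "d \<ge> 1" "star_solution G t d \<rho> R"
    and "\<And>i u j v. i \<in> {1..t} \<Longrightarrow> j \<in> {1..t} \<Longrightarrow> u \<in> verts G \<Longrightarrow> v \<in> verts G \<Longrightarrow>
           trace_inner (R i u) (R j v) = X (Some (u, i)) (Some (v, j))"
proof -
  obtain d Y where d: "d \<ge> 1" and psd: "\<And>p. p \<in> idx G t \<Longrightarrow> Y p \<in> psd_mats d"
    and gram: "\<And>p q. p \<in> idx G t \<Longrightarrow> q \<in> idx G t \<Longrightarrow> X p q = trace_inner (Y p) (Y q)"
    using assms(1) unfolding cs_plus_def by blast
  define \<rho> where "\<rho> = Y None"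
  define R where "R = (\<lambda>i u. Y (Some (u, i)))"
  have mem: "None \<in> idx G t" "\<And>i u. i \<in> {1..t} \<Longrightarrow> u \<in> verts G \<Longrightarrow> Some (u, i) \<in> idx G t"
    by (auto simp: idx_def)
  have psd': "\<rho> \<in> psd_mats d" "\<And>i u. i \<in> {1..t} \<Longrightarrow> u \<in> verts G \<Longrightarrow> R i u \<in> psd_mats d"
    unfolding \<rho>_def R_def using psd mem by blast+
  then have sym: "\<rho> \<in> sym_mats d" "\<And>i u. i \<in> {1..t} \<Longrightarrow> u \<in> verts G \<Longrightarrow> R i u \<in> sym_mats d"
    by (auto simp: psd_mats_def)
  have XR: "trace_inner (R i u) (R j v) = X (Some (u, i)) (Some (v, j))"
    if "i \<in> {1..t}" "j \<in> {1..t}" "u \<in> verts G" "v \<in> verts G" for i u j v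
    using gram mem that by (simp add: R_def)
  have X\<rho>: "trace_inner \<rho> (R i u) = X None (Some (u, i))" if "i \<in> {1..t}" "u \<in> verts G" for i u
    using gram mem that by (simp add: R_def \<rho>_def)
  have norm: "trace_inner \<rho> \<rho> = 1"
    using assms(2) gram mem by (simp add: cond_C1_def \<rho>_def)
  have "mat_sum d (R i) (verts G) = \<rho>" if i: "i \<in> {1..t}" for i
  \<comment> \<open>The symmetric form puts \<open>\<rho>\<close> in the first argument, so that the
    mixed inner product is the sum in (C2a).\<close>
  proof (rule sym_mats_eqI[symmetric])
    show "mat_sum d (R i) (verts G) \<in> sym_mats d"
      using sym(2)[OF i] by (rule mat_sum_sym)
    show "trace_inner \<rho> (mat_sum d (R i) (verts G)) = 1"
      using assms(3) i sym X\<rho> by (simp add: trace_inner_mat_sum_right cond_C2a_def)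
    show "trace_inner (mat_sum d (R i) (verts G)) (mat_sum d (R i) (verts G)) = 1"
      using assms(4) i sym XR by (simp add: trace_inner_mat_sum_both cond_C2b_def)
  qed (fact sym norm)+
  with psd' norm XR assms(5) have "star_solution G t d \<rho> R"
    by (auto simp: star_solution_def cond_O1_def)
  with d XR that show ?thesis by blast
qed

text \<open>Feasibility is compared for each fixed \<open>t\<close>, so that equality of the two
  maxima becomes a matter of rewriting.\<close>

lemma ex_star_solution_iff:
  "(\<exists>d\<ge>1. \<exists>\<rho> R. star_solution G t d \<rho> R) \<longleftrightarrow>
   (\<exists>X\<in>cs_plus (idx G t). cond_C1 X \<and> cond_C2a G t X \<and> cond_C2b G t X \<and> cond_O1 G t X)"
  (is "?L \<longleftrightarrow> ?R")
proof
  assume ?L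
  then obtain d \<rho> R where "d \<ge> 1" "star_solution G t d \<rho> R" by blast
  from star_solution_imp_gram[OF this(2,1) refl] show ?R by blast
next
  assume ?R
  then obtain X where X: "X \<in> cs_plus (idx G t)" "cond_C1 X" "cond_C2a G t X" "cond_C2b G t X"
    "cond_O1 G t X" by blast
  show ?L
    by (rule gram_imp_star_solution[OF X]) blast
qed

lemma ex_quantum_solution_iff:
  "(\<exists>d\<ge>1. \<exists>\<rho> R. quantum_solution G t d \<rho> R) \<longleftrightarrow>
   (\<exists>X\<in>cs_plus (idx G t).
      cond_C1 X \<and> cond_C2a G t X \<and> cond_C2b G t X \<and> cond_O1 G t X \<and> cond_O2 G t X)"
  (is "?L \<longleftrightarrow> ?R")
proof
  assume ?L
  then obtain d \<rho> R where d: "d \<ge> 1" and q: "quantum_solution G t d \<rho> R" by blast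
  define X where "X = (\<lambda>p q. trace_inner (case p of None \<Rightarrow> \<rho> | Some (u, i) \<Rightarrow> R i u)
                      (case q of None \<Rightarrow> \<rho> | Some (u, i) \<Rightarrow> R i u))"
  have "star_solution G t d \<rho> R" "cond_O2 G t X"
    using q by (auto simp: quantum_solution_def cond_O2_def X_def)
  with star_solution_imp_gram[OF _ d X_def] show ?R by blast
next
  assume ?R
  then obtain X where X: "X \<in> cs_plus (idx G t)" "cond_C1 X" "cond_C2a G t X" "cond_C2b G t X"
    "cond_O1 G t X" and O2: "cond_O2 G t X" by blast
  obtain d \<rho> R where "d \<ge> 1" "star_solution G t d \<rho> R"
    and "\<And>i u j v. i \<in> {1..t} \<Longrightarrow> j \<in> {1..t} \<Longrightarrow> u \<in> verts G \<Longrightarrow> v \<in> verts G \<Longrightarrow>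
           trace_inner (R i u) (R j v) = X (Some (u, i)) (Some (v, j))"
    using gram_imp_star_solution[OF X] by blast
  with O2 have "quantum_solution G t d \<rho> R"
    by (auto simp: quantum_solution_def cond_O2_def)
  with \<open>d \<ge> 1\<close> show ?L by blast
qed

section \<open>Existence of the maxima\<close>

text \<open>For \<open>t = 0\<close> every condition on the family \<open>R\<close> is vacuous, so
  any unit-norm positive semidefinite matrix works.\<close>

lemma ex_quantum_solution_0: "\<exists>d\<ge>1. \<exists>\<rho> R. quantum_solution G 0 d \<rho> R"
proof -
  let ?\<rho> = "1\<^sub>m 1 :: real mat"
  have "?\<rho> \<in> psd_mats 1"
    by (auto simp: psd_mats_def sym_mats_def scalar_prod_def)
  moreover have "trace_inner ?\<rho> ?\<rho> = 1"
    by (simp add: trace_inner_def mat_trace_def)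
  ultimately have "quantum_solution G 0 1 ?\<rho> R" for R
    by (simp add: quantum_solution_def star_solution_def)
  then show ?thesis by blast
qed

text \<open>Cauchy-Schwarz against the all-ones vector, obtained from the nonnegativity of the
  variance of \<open>g\<close>, scaled to avoid division.\<close>

lemma sum_squared_le_card:
  fixes g :: "'a \<Rightarrow> real"
  assumes "finite V"
  shows "(\<Sum>u\<in>V. g u)\<^sup>2 \<le> real (card V) * (\<Sum>u\<in>V. (g u)\<^sup>2)"
proof -
  let ?n = "real (card V)" and ?s = "\<Sum>u\<in>V. g u"
  have "0 \<le> (\<Sum>u\<in>V. (?n * g u - ?s)\<^sup>2)"
    by (simp add: sum_nonneg)
  also have "\<dots> = (\<Sum>u\<in>V. ?n\<^sup>2 * (g u)\<^sup>2 - 2 * ?n * ?s * g u + ?s\<^sup>2)"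
    by (simp add: power2_diff power_mult_distrib algebra_simps)
  also have "\<dots> = ?n\<^sup>2 * (\<Sum>u\<in>V. (g u)\<^sup>2) - 2 * ?n * ?s * ?s + ?n * ?s\<^sup>2"
    by (simp only: sum.distrib sum_subtractf sum_constant flip: sum_distrib_left)
  also have "\<dots> = ?n * (?n * (\<Sum>u\<in>V. (g u)\<^sup>2) - ?s\<^sup>2)"
    by (simp add: power2_eq_square algebra_simps)
  finally show ?thesis
    \<comment> \<open>The factor \<open>?n\<close> is cancelled, so empty \<open>V\<close> is
      treated separately.\<close>
    using assms by (cases "V = {}") (auto simp: zero_le_mult_iff card_gt_0_iff)
qed

text \<open>The counting argument in coordinates: each \<open>f i u\<close> is a vector indexed by
  \<open>P\<close>, and positive semidefiniteness survives only as the nonnegativity of inner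
  products for a common \<open>i\<close>.\<close>

lemma card_le_card_of_orthogonal_family:
  fixes f :: "'i \<Rightarrow> 'v \<Rightarrow> 'p \<Rightarrow> real"
  assumes "finite I" "finite V"
    and nonneg: "\<And>i u v. i \<in> I \<Longrightarrow> u \<in> V \<Longrightarrow> v \<in> V \<Longrightarrow> 0 \<le> (\<Sum>p\<in>P. f i u p * f i v p)"
    and orth: "\<And>i j u. i \<in> I \<Longrightarrow> j \<in> I \<Longrightarrow> u \<in> V \<Longrightarrow> i \<noteq> j \<Longrightarrow> (\<Sum>p\<in>P. f i u p * f j u p) = 0"
    and tot: "\<And>i p. i \<in> I \<Longrightarrow> p \<in> P \<Longrightarrow> (\<Sum>u\<in>V. f i u p) = r p"
    and norm: "(\<Sum>p\<in>P. (r p)\<^sup>2) = 1"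
  shows "card I \<le> card V"
proof -
  let ?n = "real (card V)" and ?t = "real (card I)"
  \<comment> \<open>The off-diagonal inner products are nonnegative, so the diagonal ones add up to
    at most the squared norm of \<open>r\<close>.\<close>
  have row: "(\<Sum>u\<in>V. \<Sum>p\<in>P. (f i u p)\<^sup>2) \<le> 1" if i: "i \<in> I" for i
  proof -
    have "(\<Sum>u\<in>V. \<Sum>p\<in>P. (f i u p)\<^sup>2) \<le> (\<Sum>u\<in>V. \<Sum>v\<in>V. \<Sum>p\<in>P. f i u p * f i v p)"
    proof (rule sum_mono)
      fix u assume u: "u \<in> V"
      then show "(\<Sum>p\<in>P. (f i u p)\<^sup>2) \<le> (\<Sum>v\<in>V. \<Sum>p\<in>P. f i u p * f i v p)"
        using member_le_sum[of u V "\<lambda>v. \<Sum>p\<in>P. f i u p * f i v p"] nonneg[OF i u] \<open>finite V\<close>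
        by (simp add: power2_eq_square)
    qed
    also have "\<dots> = (\<Sum>u\<in>V. \<Sum>p\<in>P. \<Sum>v\<in>V. f i u p * f i v p)"
      by (intro sum.cong refl sum.swap)
    also have "\<dots> = (\<Sum>p\<in>P. \<Sum>u\<in>V. \<Sum>v\<in>V. f i u p * f i v p)"
      by (rule sum.swap)
    also have "\<dots> = (\<Sum>p\<in>P. (\<Sum>u\<in>V. f i u p)\<^sup>2)"
      by (simp add: power2_eq_square sum_product)
    also have "\<dots> = 1"
      using tot[OF i] norm by simp
    finally show ?thesis .
  qed
  \<comment> \<open>Pythagoras: orthogonality for distinct indices in \<open>I\<close> removes the
    cross terms.\<close>
  have col: "(\<Sum>p\<in>P. (\<Sum>i\<in>I. f i u p)\<^sup>2) = (\<Sum>i\<in>I. \<Sum>p\<in>P. (f i u p)\<^sup>2)" if u: "u \<in> V" for u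
  proof -
    have "(\<Sum>p\<in>P. (\<Sum>i\<in>I. f i u p)\<^sup>2) = (\<Sum>p\<in>P. \<Sum>i\<in>I. \<Sum>j\<in>I. f i u p * f j u p)"
      by (simp add: power2_eq_square sum_product)
    also have "\<dots> = (\<Sum>i\<in>I. \<Sum>p\<in>P. \<Sum>j\<in>I. f i u p * f j u p)"
      by (rule sum.swap)
    also have "\<dots> = (\<Sum>i\<in>I. \<Sum>j\<in>I. \<Sum>p\<in>P. f i u p * f j u p)"
      by (intro sum.cong refl sum.swap)
    also have "\<dots> = (\<Sum>i\<in>I. \<Sum>j\<in>I. if j = i then \<Sum>p\<in>P. (f i u p)\<^sup>2 else 0)"
      using orth u by (intro sum.cong refl) (auto simp: power2_eq_square)
    also have "\<dots> = (\<Sum>i\<in>I. \<Sum>p\<in>P. (f i u p)\<^sup>2)"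
      using \<open>finite I\<close> by simp
    finally show ?thesis .
  qed
  have "?t\<^sup>2 = (\<Sum>p\<in>P. (?t * r p)\<^sup>2)"
    using norm by (simp add: power_mult_distrib flip: sum_distrib_left)
  also have "\<dots> = (\<Sum>p\<in>P. (\<Sum>u\<in>V. \<Sum>i\<in>I. f i u p)\<^sup>2)"
    using tot by (subst sum.swap) (simp cong: sum.cong)
  \<comment> \<open>Cauchy-Schwarz is applied in each coordinate \<open>p\<close>
    separately.\<close>
  also have "\<dots> \<le> (\<Sum>p\<in>P. ?n * (\<Sum>u\<in>V. (\<Sum>i\<in>I. f i u p)\<^sup>2))"
    using sum_squared_le_card[OF \<open>finite V\<close>] by (intro sum_mono)
  also have "\<dots> = ?n * (\<Sum>u\<in>V. \<Sum>p\<in>P. (\<Sum>i\<in>I. f i u p)\<^sup>2)"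
    by (subst sum.swap) (simp add: sum_distrib_left)
  also have "\<dots> = ?n * (\<Sum>i\<in>I. \<Sum>u\<in>V. \<Sum>p\<in>P. (f i u p)\<^sup>2)"
    using col by (subst sum.swap) simp
  also have "\<dots> \<le> ?n * (\<Sum>i\<in>I. 1)"
    using row by (intro mult_left_mono sum_mono) auto
  finally have "?t * ?t \<le> ?n * ?t"
    by (simp add: power2_eq_square)
  then show ?thesis
    by (cases "card I = 0") auto
qed

text \<open>Condition (c) enters through its case \<open>u = v\<close>, which gives the
  orthogonality over \<open>i\<close> at each vertex; the vectors are the matrices read
  entrywise.\<close>

lemma star_solution_bound:
  assumes "finite (verts G)" "star_solution G t d \<rho> R"
  shows "t \<le> card (verts G)"
proof -
  let ?P = "{..<d} \<times> {..<d}"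
  have psd: "\<rho> \<in> psd_mats d" "\<And>i u. i \<in> {1..t} \<Longrightarrow> u \<in> verts G \<Longrightarrow> R i u \<in> psd_mats d"
    and norm: "trace_inner \<rho> \<rho> = 1"
    and tot: "\<And>i. i \<in> {1..t} \<Longrightarrow> mat_sum d (R i) (verts G) = \<rho>"
    and orth: "\<And>i j u. i \<in> {1..t} \<Longrightarrow> j \<in> {1..t} \<Longrightarrow> u \<in> verts G \<Longrightarrow> i \<noteq> j \<Longrightarrow>
      trace_inner (R i u) (R j u) = 0"
    using assms(2) by (auto simp: star_solution_def adj_or_eq_def)
  have entry: "trace_inner A B = (\<Sum>p\<in>?P. A $$ p * B $$ p)"
    if "A \<in> psd_mats d" "B \<in> psd_mats d" for A B
    using that by (intro trace_inner_entrywise) (auto simp: psd_mats_def)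
  have "card {1..t} \<le> card (verts G)"
  proof (rule card_le_card_of_orthogonal_family)
    show "0 \<le> (\<Sum>p\<in>?P. R i u $$ p * R i v $$ p)"
      if "i \<in> {1..t}" "u \<in> verts G" "v \<in> verts G" for i u v
      using trace_inner_nonneg[of "R i u" d "R i v"] psd that by (simp add: entry)
    show "(\<Sum>p\<in>?P. R i u $$ p * R j u $$ p) = 0"
      if "i \<in> {1..t}" "j \<in> {1..t}" "u \<in> verts G" "i \<noteq> j" for i j u
      using orth[OF that] psd that by (simp add: entry)
    show "(\<Sum>u\<in>verts G. R i u $$ p) = \<rho> $$ p" if "i \<in> {1..t}" "p \<in> ?P" for i p
      using that(2) by (auto simp: mat_sum_def simp flip: tot[OF that(1)])
    show "(\<Sum>p\<in>?P. (\<rho> $$ p)\<^sup>2) = 1"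
      using norm psd by (simp add: entry power2_eq_square)
  qed (use assms(1) in auto)
  then show ?thesis by simp
qed

text \<open>\<open>GREATEST\<close> denotes an attained maximum once the predicate is satisfiable
  and bounded, hence the need for both the case \<open>t = 0\<close> and the bound by the number of
  vertices.\<close>

lemma is_maximum_Greatest:
  assumes "P k" "\<And>t. P t \<Longrightarrow> t \<le> b"
  shows "is_maximum P (GREATEST t. P t)"
  unfolding is_maximum_def
  using GreatestI_nat[of P k b] Greatest_le_nat[of P _ b] assms by blast

theorem proposition4p1:
  fixes G :: "('a, 'b) pre_digraph"
  assumes "graph G" and "verts G \<noteq> {}"
  shows "is_maximum (\<lambda>t. \<exists>X \<in> cs_plus (idx G t).
             cond_C1 X \<and> cond_C2a G t X \<and> cond_C2b G t X \<and> cond_O1 G t X \<and> cond_O2 G t X)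
           (alpha_q G) \<and>
         is_maximum (\<lambda>t. \<exists>X \<in> cs_plus (idx G t).
             cond_C1 X \<and> cond_C2a G t X \<and> cond_C2b G t X \<and> cond_O1 G t X)
           (alpha_star G)"
proof -
  interpret graph G by fact
  have "is_maximum (\<lambda>t. \<exists>d\<ge>1. \<exists>\<rho> R. quantum_solution G t d \<rho> R) (alpha_q G)"
    unfolding alpha_q_def
  proof (rule is_maximum_Greatest)
    show "t \<le> card (verts G)" if "\<exists>d\<ge>1. \<exists>\<rho> R. quantum_solution G t d \<rho> R" for t
      using that star_solution_bound[OF finite_verts] by (auto simp: quantum_solution_def)
  qed (fact ex_quantum_solution_0)
  moreover have "is_maximum (\<lambda>t. \<exists>d\<ge>1. \<exists>\<rho> R. star_solution G t d \<rho> R) (alpha_star G)"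
    unfolding alpha_star_def
  proof (rule is_maximum_Greatest)
    show "\<exists>d\<ge>1. \<exists>\<rho> R. star_solution G 0 d \<rho> R"
      using ex_quantum_solution_0[of G] by (auto simp only: quantum_solution_def)
    show "t \<le> card (verts G)" if "\<exists>d\<ge>1. \<exists>\<rho> R. star_solution G t d \<rho> R" for t
      using that by (auto dest: star_solution_bound[OF finite_verts])
  qed
  \<comment> \<open>The equivalences hold for every \<open>t\<close>, so they rewrite the predicates
    under the binder.\<close>
  ultimately show ?thesis
    unfolding ex_quantum_solution_iff ex_star_solution_iff by simp
qed

end
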